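(* Let $n\ge 3$ and let $\varphi$ be the angular distance on the unit circle $\mathbb{S}^1\subset\mathbb{R}^2$. Up to isometry, there exists a unique $M$-set of cardinality $n$ in $\mathbb{S}^1$ with respect to $\rho=\varphi$: the vertices of a regular $n$-gon inscribed in $\mathbb{S}^1$. In other words, $M(\mathbb{S}^1,\varphi,n)$ is exactly the set of configurations of $n$ points of $\mathbb{S}^1$ that are the $n$ vertices of a regular $n$-gon inscribed in $\mathbb{S}^1$.
   Context: The angular distance is $\varphi(x,y)=2\arcsin(\|x-y\|/2)\in[0,\pi]$. For a finite real sequence $A=(a_1,\dots,a_N)$ let $a_{(1)}\le\dots\le a_{(N)}$ be its elements in non-decreasing order. For real sequences $A,B$ of the same length $N$, write $A\vartriangleright B$ if $a_{(1)}+\dots+a_{(k)}\ge b_{(1)}+\dots+b_{(k)}$ for all $k=1,\dots,N$. $A$ and $B$ are incomparable if neither $A\vartriangleright B$ nor $B\vartriangleright A$. For a set $S$, a symmetric function $\rho:S\times S\to\mathbb{R}$ and $X=(x_1,\dots,x_m)\in S^m$, let $R_\rho(X)$ be the sequence of the $m(m-1)/2$ numbers $\rho(x_i,x_j)$, $1\le i<j\le m$ (with repetition). $X\in S^m$ is an $M$-set in $S$ with respect to $\rho$ if for every $Y\in S^m$ either $R_\rho(X)\vartriangleright R_\rho(Y)$, or $R_\rho(X)$ and $R_\rho(Y)$ are incomparable. $M(S,\rho,m)$ denotes the set of all $M$-sets $X\in S^m$; the order of the points is irrelevant. *)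

theory Defs
  imports "HOL-Analysis.Analysis" "HOL-Library.Multiset"
begin

definition angular_dist :: "'a::real_normed_vector \<Rightarrow> 'a \<Rightarrow> real" where
  "angular_dist x y = 2 * arcsin (norm (x - y) / 2)"

text \<open>Finite real sequences are lists; \<open>sort\<close> puts them in non-decreasing order.\<close>

definition dominates :: "real list \<Rightarrow> real list \<Rightarrow> bool"  (infix "\<triangleright>" 50) where
  "A \<triangleright> B \<longleftrightarrow> length A = length B \<and>
     (\<forall>k\<in>{1..length A}. sum_list (take k (sort A)) \<ge> sum_list (take k (sort B)))"

definition incomparable :: "real list \<Rightarrow> real list \<Rightarrow> bool" where
  "incomparable A B \<longleftrightarrow> \<not> A \<triangleright> B \<and> \<not> B \<triangleright> A"

definition pair_values :: "('a \<Rightarrow> 'a \<Rightarrow> real) \<Rightarrow> 'a list \<Rightarrow> real list" where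
  "pair_values \<rho> X = [\<rho> (X ! i) (X ! j). i \<leftarrow> [0..<length X], j \<leftarrow> [Suc i..<length X]]"

definition tuples :: "'a set \<Rightarrow> nat \<Rightarrow> 'a list set" where
  "tuples S m = {X. set X \<subseteq> S \<and> length X = m}"

text \<open>
  M-sets are kept as ordered tuples, possibly with repeated points; the set is closed under
  permutation of the entries.
\<close>

definition M_sets :: "'a set \<Rightarrow> ('a \<Rightarrow> 'a \<Rightarrow> real) \<Rightarrow> nat \<Rightarrow> 'a list set" where
  "M_sets S \<rho> m = {X \<in> tuples S m. \<forall>Y \<in> tuples S m.
     pair_values \<rho> X \<triangleright> pair_values \<rho> Y \<or>
     incomparable (pair_values \<rho> X) (pair_values \<rho> Y)}"

definition unit_circle :: "(real^2) set" where
  "unit_circle = sphere 0 1"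

definition regular_ngon_vertices :: "nat \<Rightarrow> real \<Rightarrow> (real^2) set" where
  "regular_ngon_vertices n \<theta> =
     (\<lambda>k. vector [cos (\<theta> + 2 * pi * real k / real n), sin (\<theta> + 2 * pi * real k / real n)]) ` {..<n}"

text \<open>
  For \<open>n > 0\<close> the vertex set has \<open>n\<close> elements, so a list of length \<open>n\<close> with this underlying set
  enumerates every vertex exactly once.
\<close>

definition is_regular_ngon :: "nat \<Rightarrow> (real^2) list \<Rightarrow> bool" where
  "is_regular_ngon n X \<longleftrightarrow> length X = n \<and> (\<exists>\<theta>. set X = regular_ngon_vertices n \<theta>)"

text \<open>
  Isometry of configurations, regardless of the order of the points: the isometries of the unit
  circle are the restrictions of the orthogonal transformations of the plane.
\<close>

definition isometric_configs :: "(real^2) list \<Rightarrow> (real^2) list \<Rightarrow> bool" where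
  "isometric_configs X Y \<longleftrightarrow>
     (\<exists>f. orthogonal_transformation f \<and> mset (map f X) = mset Y)"

end

theory Submission
  imports Defs
begin

text \<open>
  A regular \<open>n\<close>-gon does not merely resist domination: its list of distances dominates that of
  every \<open>n\<close>-point configuration on the circle.  The theorem follows.  Regular polygons are
  M-sets, and a configuration that is an M-set cannot be incomparable with the regular polygon,
  so it dominates it.  Comparing only the smallest entries of the two lists, all points
  of the M-set are at mutual angular distance at least \<open>2 * pi / n\<close>.  The \<open>n\<close> gaps between
  cyclically consecutive points add up to \<open>2 * pi\<close>, so each of them is exactly \<open>2 * pi / n\<close>
  (\<open>regular_if_separated\<close>).  Regular polygons are carried into each other by rotations.

  For the domination (\<open>regular_polygon_dominates\<close>), sums of \<open>k\<close> smallest entries are traded for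
  the sums of the truncated entries \<open>min t a\<close>, for all thresholds \<open>t\<close>
  (\<open>dominatesI_truncated\<close>).  Sort the points by angle and go round the circle.  For a
  fixed step \<open>s\<close>, the \<open>n\<close> counterclockwise arcs from each point to the \<open>s\<close>-th next one have total
  length \<open>2 * pi * s\<close>, because together they cover the circle \<open>s\<close> times.  The truncated distance
  belonging to an arc \<open>d\<close> is \<open>min t (min d (2 * pi - d))\<close>, which is a minimum of affine functions
  of \<open>d\<close>; hence it is concave, and its sum over the \<open>n\<close> arcs is largest when all arcs are
  equal (\<open>arc_trunc_step_sum_le\<close>).  The regular polygon makes the arcs equal for all steps
  \<open>s\<close> at once, and summing over \<open>s\<close> counts every pair of points twice.
\<close>

section \<open>Dominance from truncated sums\<close>

text \<open>
  For a sorted list, the sum of the first \<open>k\<close> entries is the maximum over \<open>t\<close> of the right-hand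
  side.  The bound holds because the first \<open>k\<close> entries are at least their truncations, while the
  truncations of the others are at most \<open>t\<close>.
\<close>

lemma take_sum_list_ge_truncated:
  fixes A :: "real list"
  assumes "k \<le> length A"
  shows "sum_list (take k A) \<ge> sum_list (map (min t) A) - real (length A - k) * t"
proof -
  have "sum_list (map (min t) A)
      = sum_list (map (min t) (take k A)) + sum_list (map (min t) (drop k A))"
    by (metis append_take_drop_id map_append sum_list_append)
  moreover have "sum_list (map (min t) (take k A)) \<le> sum_list (map (\<lambda>a. a) (take k A))"
    by (rule sum_list_mono) auto
  moreover have "sum_list (map (min t) (drop k A)) \<le> sum_list (map (\<lambda>_. t) (drop k A))"
    by (rule sum_list_mono) auto
  ultimately show ?thesis
    by (simp add: sum_list_triv)
qed

text \<open>The maximum is attained when the threshold is the \<open>k\<close>-th smallest entry.\<close>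

lemma take_sum_list_sorted_eq_truncated:
  fixes A :: "real list"
  assumes "sorted A" "1 \<le> k" "k \<le> length A"
  defines "t \<equiv> A ! (k - 1)"
  shows "sum_list (take k A) = sum_list (map (min t) A) - real (length A - k) * t"
proof -
  have lo: "a \<le> t" if a: "a \<in> set (take k A)" for a
  proof -
    obtain i where "i < length (take k A)" "take k A ! i = a"
      using a by (metis in_set_conv_nth)
    then show ?thesis
      unfolding t_def using sorted_nth_mono[OF assms(1), of i "k - 1"] assms(2,3) by simp
  qed
  have hi: "t \<le> a" if a: "a \<in> set (drop k A)" for a
  proof -
    obtain i where "i < length (drop k A)" "drop k A ! i = a"
      using a by (metis in_set_conv_nth)
    then show ?thesis
      unfolding t_def using sorted_nth_mono[OF assms(1), of "k - 1" "k + i"] assms(2,3) by simp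
  qed
  have "sum_list (map (min t) A)
      = sum_list (map (min t) (take k A)) + sum_list (map (min t) (drop k A))"
    by (metis append_take_drop_id map_append sum_list_append)
  also have "map (min t) (take k A) = take k A"
    by (rule map_idI) (use lo in \<open>auto simp: min_def intro: antisym\<close>)
  also have "map (min t) (drop k A) = map (\<lambda>_. t) (drop k A)"
    using hi by (auto simp: min_def)
  finally show ?thesis
    by (simp add: sum_list_triv)
qed

lemma sum_list_map_sort:
  fixes f :: "real \<Rightarrow> real"
  shows "sum_list (map f (sort A)) = sum_list (map f A)"
  by (metis mset_map mset_sort sum_mset_sum_list)

text \<open>
  The threshold is chosen to be optimal for \<open>B\<close>, the sequence to be dominated; for \<open>A\<close> the same
  threshold still gives a lower bound.
\<close>

lemma dominatesI_truncated:
  assumes len: "length A = length B"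
    and le: "\<And>t. sum_list (map (min t) B) \<le> sum_list (map (min t) A)"
  shows "A \<triangleright> B"
  unfolding dominates_def
proof (intro conjI ballI len)
  fix k assume k: "k \<in> {1..length A}"
  define t where "t = sort B ! (k - 1)"
  have "sum_list (take k (sort B)) = sum_list (map (min t) B) - real (length B - k) * t"
    using take_sum_list_sorted_eq_truncated[of "sort B" k] k len
    by (simp add: t_def sum_list_map_sort)
  also have "\<dots> \<le> sum_list (map (min t) A) - real (length A - k) * t"
    using le[of t] len by simp
  also have "\<dots> \<le> sum_list (take k (sort A))"
    using take_sum_list_ge_truncated[of k "sort A" t] k by (simp add: sum_list_map_sort)
  finally show "sum_list (take k (sort B)) \<le> sum_list (take k (sort A))" .
qed

text \<open>Domination for \<open>k = 1\<close> compares the minima.\<close>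

lemma dominates_imp_lower_bound:
  assumes dom: "A \<triangleright> B" and lb: "\<And>b. b \<in> set B \<Longrightarrow> c \<le> b" and a: "a \<in> set A"
  shows "c \<le> a"
proof -
  have ne: "A \<noteq> []" "B \<noteq> []"
    using a dom by (auto simp: dominates_def)
  then have nes: "sort A \<noteq> []" "sort B \<noteq> []"
    by (metis set_empty set_sort)+
  have "1 \<in> {1..length A}"
    using ne by (simp add: Suc_le_eq)
  then have "sum_list (take 1 (sort B)) \<le> sum_list (take 1 (sort A))"
    using dom unfolding dominates_def by blast
  then have "hd (sort B) \<le> hd (sort A)"
    using nes by (simp add: take_Suc)
  moreover have "c \<le> hd (sort B)"
    using lb nes by (metis hd_in_set set_sort)
  moreover have "hd (sort A) \<le> a"
    using a nes by (metis list.exhaust_sel order_refl set_ConsD set_sort sorted_simps(2) sorted_sort)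
  ultimately show ?thesis by linarith
qed

section \<open>Pair values\<close>

lemma pair_values_Cons:
  "pair_values \<rho> (x # xs) = map (\<rho> x) xs @ pair_values \<rho> xs"
proof -
  have "map (\<lambda>j. \<rho> x ((x # xs) ! j)) [Suc 0..<Suc (length xs)] = map (\<rho> x) xs"
    by (rule nth_equalityI) (auto simp del: upt_Suc)
  moreover have "[0..<Suc (length xs)] = 0 # map Suc [0..<length xs]"
    by (simp add: map_Suc_upt upt_conv_Cons del: upt_Suc)
  moreover have "[Suc (Suc i)..<Suc (length xs)] = map Suc [Suc i..<length xs]" for i
    by (simp add: map_Suc_upt)
  ultimately show ?thesis
    by (simp add: pair_values_def o_def del: upt_Suc)
qed

lemma length_pair_values:
  "length X = length Y \<Longrightarrow> length (pair_values \<rho> X) = length (pair_values \<rho> Y)"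
proof (induction X Y rule: list_induct2)
  case Nil
  show ?case by (simp add: pair_values_def)
qed (simp add: pair_values_Cons)

text \<open>
  The double sum on the right, over all ordered pairs, visibly depends only on the multiset of
  points.  With \<open>f\<close> the indicator of one value it counts the occurrences of that value, so the
  multiset of pair values does not depend on the order of the points.
\<close>

lemma twice_sum_list_pair_values:
  fixes f :: "real \<Rightarrow> nat"
  assumes sym: "\<And>x y. \<rho> x y = \<rho> y x"
  shows "2 * sum_list (map f (pair_values \<rho> X)) + (\<Sum>x\<leftarrow>X. f (\<rho> x x))
    = (\<Sum>x\<leftarrow>X. \<Sum>y\<leftarrow>X. f (\<rho> x y))"
proof (induction X)
  case Nil
  then show ?case by (simp add: pair_values_def)
next
  case (Cons x xs)
  have "(\<Sum>y\<leftarrow>xs. f (\<rho> y x)) = (\<Sum>y\<leftarrow>xs. f (\<rho> x y))"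
    by (simp add: sym)
  then show ?case
    using Cons.IH by (simp add: pair_values_Cons o_def sum_list_addf)
qed

lemma mset_pair_values_cong:
  fixes X Y :: "'a list"
  assumes sym: "\<And>x y. \<rho> x y = \<rho> y x" and XY: "mset X = mset Y"
  shows "mset (pair_values \<rho> X) = mset (pair_values \<rho> Y)"
proof (rule multiset_eqI)
  fix v
  define f where "f = (\<lambda>u :: real. if u = v then 1 else 0 :: nat)"
  have inv: "sum_list (map g X) = sum_list (map g Y)" for g :: "'a \<Rightarrow> nat"
    by (metis XY mset_map sum_mset_sum_list)
  have "2 * sum_list (map f (pair_values \<rho> X)) + (\<Sum>x\<leftarrow>X. f (\<rho> x x))
      = 2 * sum_list (map f (pair_values \<rho> Y)) + (\<Sum>x\<leftarrow>Y. f (\<rho> x x))"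
    unfolding twice_sum_list_pair_values[of \<rho>, OF sym] by (simp add: inv)
  then have "sum_list (map f (pair_values \<rho> X)) = sum_list (map f (pair_values \<rho> Y))"
    by (simp add: inv)
  moreover have "count (mset L) v = sum_list (map f L)" for L :: "real list"
    by (induction L) (auto simp: f_def)
  ultimately show "count (mset (pair_values \<rho> X)) v = count (mset (pair_values \<rho> Y)) v"
    by simp
qed

lemma dominates_mset_cong:
  "\<lbrakk>mset A = mset A'; mset B = mset B'\<rbrakk> \<Longrightarrow> A \<triangleright> B \<longleftrightarrow> A' \<triangleright> B'"
  unfolding dominates_def by (metis mset_eq_length sorted_list_of_multiset_mset)

lemma set_pair_values:
  "set (pair_values \<rho> X) = {\<rho> (X ! i) (X ! j) | i j. i < j \<and> j < length X}"
  by (fastforce simp: pair_values_def)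

lemma pair_value_mem:
  "\<lbrakk>i < j; j < length X\<rbrakk> \<Longrightarrow> \<rho> (X ! i) (X ! j) \<in> set (pair_values \<rho> X)"
  unfolding set_pair_values by blast

lemma sum_list_pair_values:
  "sum_list (map f (pair_values \<rho> X))
    = (\<Sum>i<length X. \<Sum>j\<in>{Suc i..<length X}. f (\<rho> (X ! i) (X ! j)) :: real)"
proof -
  have sum_concat: "sum_list (concat xss) = sum_list (map sum_list xss)" for xss :: "real list list"
    by (induction xss) auto
  show ?thesis
    by (simp add: pair_values_def map_concat sum_concat o_def
        interv_sum_list_conv_sum_set_nat atLeast0LessThan)
qed

section \<open>Circular sums\<close>

lemma sum_pairs_by_step:
  fixes h :: "nat \<Rightarrow> nat \<Rightarrow> real"
  shows "(\<Sum>i<n. \<Sum>j\<in>{Suc i..<n}. h i j) = (\<Sum>s\<in>{1..<n}. \<Sum>i<n-s. h i (i + s))"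
proof -
  have "(\<Sum>i<n. \<Sum>j\<in>{Suc i..<n}. h i j) = (\<Sum>(i,j)\<in>(SIGMA i:{..<n}. {Suc i..<n}). h i j)"
    by (simp add: sum.Sigma)
  also have "\<dots> = (\<Sum>(s,i)\<in>(SIGMA s:{1..<n}. {..<n-s}). h i (i + s))"
    by (rule sum.reindex_bij_witness[where i = "\<lambda>(s,i). (i, i + s)" and j = "\<lambda>(i,j). (j - i, i)"])
      auto
  also have "\<dots> = (\<Sum>s\<in>{1..<n}. \<Sum>i<n-s. h i (i + s))"
    by (simp add: sum.Sigma)
  finally show ?thesis .
qed

text \<open>
  Step \<open>s\<close> along the cyclic order on \<open>{..<n}\<close> either goes up by \<open>s\<close> or wraps around, going down by
  \<open>n - s\<close>.  Each unordered pair is thus met twice, once going up by \<open>s\<close> and once at step \<open>n - s\<close>, wrapping around.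
\<close>

lemma twice_sum_pairs_by_step:
  fixes h :: "nat \<Rightarrow> nat \<Rightarrow> real"
  shows "2 * (\<Sum>i<n. \<Sum>j\<in>{Suc i..<n}. h i j)
    = (\<Sum>s\<in>{1..<n}. (\<Sum>i<n-s. h i (i + s)) + (\<Sum>i<s. h i (i + (n - s))))"
proof -
  have "(\<Sum>s\<in>{1..<n}. \<Sum>i<n-s. h i (i + s)) = (\<Sum>s\<in>{1..<n}. \<Sum>i<s. h i (i + (n - s)))"
    by (rule sum.reindex_bij_witness[where i = "\<lambda>s. n - s" and j = "\<lambda>s. n - s"]) auto
  then show ?thesis
    by (simp add: sum_pairs_by_step sum.distrib)
qed

lemma sum_lessThan_add:
  fixes f :: "nat \<Rightarrow> real"
  shows "(\<Sum>i<a + b. f i) = (\<Sum>i<a. f i) + (\<Sum>i<b. f (i + a))"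
  by (induction b) (auto simp: add.commute)

text \<open>
  With \<open>c\<close> the length of the circle, the summands are the \<open>n\<close> arcs of step \<open>s\<close>; those in the
  second sum pass the origin.  Each angle occurs once as a start and once as an end, so only the
  \<open>s\<close> passages through the origin remain.
\<close>

lemma sum_cyclic_gaps:
  fixes \<alpha> :: "nat \<Rightarrow> real"
  assumes "s \<le> n"
  shows "(\<Sum>i<n-s. \<alpha> (i + s) - \<alpha> i) + (\<Sum>i<s. c - (\<alpha> (i + (n - s)) - \<alpha> i)) = c * real s"
  using sum_lessThan_add[of \<alpha> s "n - s"] sum_lessThan_add[of \<alpha> "n - s" s] assms
  by (simp add: sum_subtractf)

text \<open>
  For \<open>0 \<le> d \<le> 2 * pi\<close>, the angular distance between the ends of an arc of length \<open>d\<close>,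
  truncated at \<open>t\<close>.
\<close>

definition arc_trunc :: "real \<Rightarrow> real \<Rightarrow> real" where
  "arc_trunc t d = min t (min d (2 * pi - d))"

text \<open>
  Jensen's inequality for the concave function \<open>arc_trunc t\<close> and the arcs of step \<open>s\<close>.  Since the
  function is a minimum of three affine ones, it suffices to bound the sum by each of the three
  affine sums, which are known from the total length of the arcs.  An arc that passes the origin is
  replaced by its complement, which has the same distance.
\<close>

lemma arc_trunc_step_sum_le:
  fixes \<alpha> :: "nat \<Rightarrow> real"
  assumes s: "s \<le> n" and n: "0 < n"
  shows "(\<Sum>i<n-s. arc_trunc t (\<alpha> (i + s) - \<alpha> i)) + (\<Sum>i<s. arc_trunc t (\<alpha> (i + (n - s)) - \<alpha> i))
    \<le> real n * arc_trunc t (2 * pi * real s / real n)" (is "?P + ?Q \<le> _")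
proof -
  have "?P \<le> (\<Sum>i<n-s. t)" "?Q \<le> (\<Sum>i<s. t)"
    by (rule sum_mono; simp add: arc_trunc_def)+
  then have 1: "?P + ?Q \<le> real n * t"
    using s by (simp add: of_nat_diff algebra_simps)
  have "?P \<le> (\<Sum>i<n-s. \<alpha> (i + s) - \<alpha> i)" "?Q \<le> (\<Sum>i<s. 2 * pi - (\<alpha> (i + (n - s)) - \<alpha> i))"
    by (rule sum_mono; simp add: arc_trunc_def)+
  then have 2: "?P + ?Q \<le> 2 * pi * real s"
    using sum_cyclic_gaps[OF s, of \<alpha> "2 * pi"] by linarith
  have "?P \<le> (\<Sum>i<n-s. 2 * pi - (\<alpha> (i + s) - \<alpha> i))" "?Q \<le> (\<Sum>i<s. \<alpha> (i + (n - s)) - \<alpha> i)"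
    by (rule sum_mono; simp add: arc_trunc_def)+
  then have 3: "?P + ?Q \<le> 2 * pi * real (n - s)"
    using sum_cyclic_gaps[of "n - s" n \<alpha> "2 * pi"] s by simp
  have "real n * arc_trunc t (2 * pi * real s / real n)
      = min (real n * t) (min (2 * pi * real s) (2 * pi * real (n - s)))"
    using n s by (simp add: arc_trunc_def min_mult_distrib_left of_nat_diff algebra_simps)
  with 1 2 3 show ?thesis by simp
qed

lemma arc_trunc_step_sum_equal_gaps:
  assumes s: "s \<le> n" and n: "0 < n"
    and \<alpha>: "\<And>i. i < n \<Longrightarrow> \<alpha> i = \<theta> + 2 * pi * real i / real n"
  shows "(\<Sum>i<n-s. arc_trunc t (\<alpha> (i + s) - \<alpha> i)) + (\<Sum>i<s. arc_trunc t (\<alpha> (i + (n - s)) - \<alpha> i))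
    = real n * arc_trunc t (2 * pi * real s / real n)" (is "?P + ?Q = real n * ?v")
proof -
  have "?P = (\<Sum>i<n-s. ?v)"
  proof (rule sum.cong[OF refl])
    fix i assume "i \<in> {..<n-s}"
    then have "\<alpha> (i + s) - \<alpha> i = 2 * pi * real s / real n"
      by (simp add: \<alpha> add_divide_distrib algebra_simps)
    then show "arc_trunc t (\<alpha> (i + s) - \<alpha> i) = ?v" by simp
  qed
  moreover have "?Q = (\<Sum>i<s. ?v)"
  proof (rule sum.cong[OF refl])
    fix i assume i: "i \<in> {..<s}"
    then have "\<alpha> (i + (n - s)) = \<theta> + 2 * pi * real (i + (n - s)) / real n"
      using s by (intro \<alpha>) auto
    moreover have "\<alpha> i = \<theta> + 2 * pi * real i / real n"
      using s i by (intro \<alpha>) auto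
    ultimately have "\<alpha> (i + (n - s)) - \<alpha> i = 2 * pi - 2 * pi * real s / real n"
      using s n by (simp add: of_nat_diff field_simps)
    then show "arc_trunc t (\<alpha> (i + (n - s)) - \<alpha> i) = ?v"
      by (simp add: arc_trunc_def min.commute)
  qed
  moreover have "real (n - s) * ?v + real s * ?v = real n * ?v"
    using s by (simp add: of_nat_diff left_diff_distrib)
  ultimately show ?thesis by simp
qed

section \<open>Points of the circle by angle\<close>

definition circle_pt :: "real \<Rightarrow> real^2" where
  "circle_pt a = vector [cos a, sin a]"

lemma norm_vec2: "norm (v :: real^2) = sqrt ((v $ 1)\<^sup>2 + (v $ 2)\<^sup>2)"
  by (simp add: norm_vec_def L2_set_def sum_2)

lemma circle_pt_in_unit_circle [simp]: "circle_pt a \<in> unit_circle"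
  by (simp add: unit_circle_def norm_vec2 circle_pt_def)

lemma angular_dist_circle_pt:
  assumes "\<bar>a - b\<bar> \<le> 2 * pi"
  shows "angular_dist (circle_pt a) (circle_pt b) = min \<bar>a - b\<bar> (2 * pi - \<bar>a - b\<bar>)"
proof -
  \<comment> \<open>The chord has length \<open>2 * sin u\<close>, and \<open>arcsin\<close> inverts \<open>sin\<close> only for \<open>u \<le> pi / 2\<close>; beyond
    that it returns \<open>pi - u\<close>, half of the complementary arc.\<close>
  define u where "u = \<bar>a - b\<bar> / 2"
  have u: "0 \<le> u" "u \<le> pi" using assms by (auto simp: u_def)
  have "(cos a - cos b)\<^sup>2 + (sin a - sin b)\<^sup>2 = 2 - 2 * cos (a - b)"
    using sin_cos_squared_add[of a] sin_cos_squared_add[of b]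
    by (simp add: cos_diff power2_eq_square algebra_simps)
  also have "cos (a - b) = cos (2 * u)"
    by (simp add: u_def)
  also have "2 - 2 * cos (2 * u) = (2 * sin u)\<^sup>2"
    by (simp add: cos_double_sin power2_eq_square)
  finally have "norm (circle_pt a - circle_pt b) = 2 * sin u"
    using u by (simp add: norm_vec2 circle_pt_def sin_ge_zero real_sqrt_mult)
  then have *: "angular_dist (circle_pt a) (circle_pt b) = 2 * arcsin (sin u)"
    by (simp add: angular_dist_def)
  show ?thesis
  proof (cases "u \<le> pi / 2")
    case True
    then show ?thesis using * u by (simp add: arcsin_sin u_def)
  next
    case False
    have "arcsin (sin u) = arcsin (sin (pi - u))" by simp
    also have "\<dots> = pi - u" by (rule arcsin_sin) (use u False in auto)
    finally show ?thesis using * False by (simp add: u_def)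
  qed
qed

lemma angular_dist_commute: "angular_dist x y = angular_dist y x"
  by (simp add: angular_dist_def norm_minus_commute)

lemma mset_angular_pair_values_cong:
  "mset X = mset Y \<Longrightarrow> mset (pair_values angular_dist X) = mset (pair_values angular_dist Y)"
  by (rule mset_pair_values_cong) (rule angular_dist_commute)

lemma ex_sorted_angles:
  assumes "set X \<subseteq> unit_circle"
  obtains as where "sorted as" "set as \<subseteq> {0..<2 * pi}" "mset X = mset (map circle_pt as)"
proof -
  have "\<exists>t. 0 \<le> t \<and> t < 2 * pi \<and> circle_pt t = x" if "x \<in> unit_circle" for x
  proof -
    have "(x $ 1)\<^sup>2 + (x $ 2)\<^sup>2 = 1"
      using that by (simp add: unit_circle_def norm_vec2)
    then obtain t where "0 \<le> t" "t < 2 * pi" "x $ 1 = cos t" "x $ 2 = sin t"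
      by (rule sincos_total_2pi)
    then have "circle_pt t = x"
      by (simp add: circle_pt_def vec_eq_iff forall_2)
    then show ?thesis using \<open>0 \<le> t\<close> \<open>t < 2 * pi\<close> by blast
  qed
  then obtain arg where arg: "\<And>x. x \<in> unit_circle \<Longrightarrow> 0 \<le> arg x \<and> arg x < 2 * pi \<and> circle_pt (arg x) = x"
    by metis
  show thesis
  proof
    show "sorted (sort (map arg X))" by simp
    show "set (sort (map arg X)) \<subseteq> {0..<2 * pi}" using arg assms by auto
    have "map (circle_pt \<circ> arg) X = X"
      by (rule map_idI) (use arg assms in auto)
    then show "mset X = mset (map circle_pt (sort (map arg X)))"
      by (metis map_map mset_map mset_sort)
  qed
qed

lemma twice_truncated_sum_eq_step_sums:
  assumes "\<And>i j. i \<le> j \<Longrightarrow> j < length as \<Longrightarrow> 0 \<le> as ! j - as ! i \<and> as ! j - as ! i \<le> 2 * pi"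
  shows "2 * sum_list (map (min t) (pair_values angular_dist (map circle_pt as)))
   = (\<Sum>s\<in>{1..<length as}. (\<Sum>i<length as-s. arc_trunc t (as ! (i + s) - as ! i))
        + (\<Sum>i<s. arc_trunc t (as ! (i + (length as - s)) - as ! i)))"
proof -
  have "min t (angular_dist (circle_pt (as ! i)) (circle_pt (as ! j))) = arc_trunc t (as ! j - as ! i)"
    if "i < j" "j < length as" for i j
    using assms[of i j] that
    by (simp add: angular_dist_circle_pt arc_trunc_def abs_minus_commute[of "as ! i"])
  then have "sum_list (map (min t) (pair_values angular_dist (map circle_pt as)))
      = (\<Sum>i<length as. \<Sum>j\<in>{Suc i..<length as}. arc_trunc t (as ! j - as ! i))"
    by (simp add: sum_list_pair_values)
  then show ?thesis
    by (simp add: twice_sum_pairs_by_step[of "\<lambda>i j. arc_trunc t (as ! j - as ! i)"])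
qed

section \<open>Regular polygons\<close>

definition regular_angles :: "nat \<Rightarrow> real \<Rightarrow> real list" where
  "regular_angles n \<theta> = map (\<lambda>k. \<theta> + 2 * pi * real k / real n) [0..<n]"

lemma length_regular_angles [simp]: "length (regular_angles n \<theta>) = n"
  by (simp add: regular_angles_def)

lemma regular_angles_diff:
  assumes "i \<le> j" "j < n"
  shows "regular_angles n \<theta> ! j - regular_angles n \<theta> ! i = 2 * pi * real (j - i) / real n"
  using assms by (simp add: regular_angles_def of_nat_diff diff_divide_distrib algebra_simps)

lemma regular_angles_diff_bounds:
  assumes "i \<le> j" "j < n"
  shows "0 \<le> regular_angles n \<theta> ! j - regular_angles n \<theta> ! i"
    "regular_angles n \<theta> ! j - regular_angles n \<theta> ! i \<le> 2 * pi - 2 * pi / real n"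
proof -
  have "real (j - i) \<le> real n - 1" using assms by linarith
  then have "2 * pi * real (j - i) \<le> 2 * pi * (real n - 1)" by simp
  then have "2 * pi * real (j - i) / real n \<le> 2 * pi * (real n - 1) / real n"
    by (rule divide_right_mono) simp
  then show "regular_angles n \<theta> ! j - regular_angles n \<theta> ! i \<le> 2 * pi - 2 * pi / real n"
    using assms by (simp add: regular_angles_diff diff_divide_distrib right_diff_distrib)
qed (use assms in \<open>simp add: regular_angles_diff\<close>)

text \<open>
  This bound is used twice: it gives the separation of every M-set, and it shows that the
  vertices are distinct.
\<close>

lemma regular_polygon_dist_ge:
  assumes "d \<in> set (pair_values angular_dist (map circle_pt (regular_angles n \<theta>)))"
  shows "2 * pi / real n \<le> d"
proof -
  obtain i j where ij: "i < j" "j < n"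
    and d: "d = angular_dist (circle_pt (regular_angles n \<theta> ! i)) (circle_pt (regular_angles n \<theta> ! j))"
    using assms by (auto simp: set_pair_values)
  let ?D = "regular_angles n \<theta> ! j - regular_angles n \<theta> ! i"
  have "0 \<le> ?D" "?D \<le> 2 * pi - 2 * pi / real n"
    using regular_angles_diff_bounds[of i j n \<theta>] ij by auto
  moreover have "0 \<le> 2 * pi / real n" by simp
  ultimately have "0 \<le> ?D" "?D \<le> 2 * pi" by linarith+
  then have "d = min ?D (2 * pi - ?D)"
    using d angular_dist_circle_pt[of "regular_angles n \<theta> ! j" "regular_angles n \<theta> ! i"]
    by (simp add: angular_dist_commute)
  moreover have "2 * pi / real n \<le> ?D"
    using ij by (simp add: regular_angles_diff divide_right_mono)
  ultimately show ?thesis using \<open>?D \<le> 2 * pi - 2 * pi / real n\<close> by simp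
qed

lemma distinct_regular_polygon: "distinct (map circle_pt (regular_angles n \<theta>))"
proof (rule ccontr)
  let ?X = "map circle_pt (regular_angles n \<theta>)"
  assume "\<not> distinct ?X"
  then obtain i j where ij: "i < j" "j < n" "?X ! i = ?X ! j"
    unfolding distinct_conv_nth by (metis length_map length_regular_angles linorder_neqE_nat)
  then have "angular_dist (?X ! i) (?X ! j) \<in> set (pair_values angular_dist ?X)"
    by (intro pair_value_mem) auto
  from regular_polygon_dist_ge[OF this] ij have "2 * pi / real n \<le> 0"
    by (simp add: angular_dist_def)
  moreover have "0 < 2 * pi / real n" using ij by simp
  ultimately show False by linarith
qed

lemma set_regular_polygon:
  "set (map circle_pt (regular_angles n \<theta>)) = regular_ngon_vertices n \<theta>"
  by (auto simp: regular_angles_def regular_ngon_vertices_def circle_pt_def image_image)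

text \<open>
  Equality of vertex sets is upgraded to equality of multisets: a list of \<open>n\<close> points
  that covers \<open>n\<close> distinct vertices has no repetition.
\<close>

lemma is_regular_ngon_iff_mset:
  "is_regular_ngon n X \<longleftrightarrow> (\<exists>\<theta>. mset X = mset (map circle_pt (regular_angles n \<theta>)))"
proof
  assume "is_regular_ngon n X"
  then obtain \<theta> where X: "length X = n" "set X = set (map circle_pt (regular_angles n \<theta>))"
    unfolding is_regular_ngon_def set_regular_polygon by blast
  then have "distinct X"
    by (metis card_distinct distinct_card distinct_regular_polygon length_map length_regular_angles)
  then show "\<exists>\<theta>. mset X = mset (map circle_pt (regular_angles n \<theta>))"
    using X distinct_regular_polygon set_eq_iff_mset_eq_distinct by blast
next
  assume "\<exists>\<theta>. mset X = mset (map circle_pt (regular_angles n \<theta>))"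
  then obtain \<theta> where "mset X = mset (map circle_pt (regular_angles n \<theta>))" ..
  then show "is_regular_ngon n X"
    unfolding is_regular_ngon_def
    by (metis length_map length_regular_angles mset_eq_length mset_eq_setD set_regular_polygon)
qed

text \<open>
  The step sums of \<open>Y\<close> are bounded by Jensen's inequality, and for the regular polygon, where all
  arcs of the same step are equal, the bound is attained for every step and every
  threshold.
\<close>

lemma regular_polygon_dominates:
  assumes Y: "set Y \<subseteq> unit_circle" "length Y = n"
  shows "pair_values angular_dist (map circle_pt (regular_angles n \<theta>)) \<triangleright> pair_values angular_dist Y"
proof -
  obtain as where as: "sorted as" "set as \<subseteq> {0..<2 * pi}" "mset Y = mset (map circle_pt as)"
    using ex_sorted_angles[OF Y(1)] .
  have len: "length as = n" using as(3) Y(2) by (metis length_map mset_eq_length)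
  let ?R = "regular_angles n \<theta>"
  have "pair_values angular_dist (map circle_pt ?R) \<triangleright> pair_values angular_dist (map circle_pt as)"
  proof (rule dominatesI_truncated)
    show "length (pair_values angular_dist (map circle_pt ?R))
        = length (pair_values angular_dist (map circle_pt as))"
      by (rule length_pair_values) (simp add: len)
    fix t
    have "2 * sum_list (map (min t) (pair_values angular_dist (map circle_pt as)))
      = (\<Sum>s\<in>{1..<n}. (\<Sum>i<n-s. arc_trunc t (as ! (i + s) - as ! i))
          + (\<Sum>i<s. arc_trunc t (as ! (i + (n - s)) - as ! i)))"
      unfolding len[symmetric]
    proof (rule twice_truncated_sum_eq_step_sums)
      fix i j assume ij: "i \<le> j" "j < length as"
      then have "as ! i \<le> as ! j" using as(1) by (simp add: sorted_nth_mono)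
      moreover have "as ! i \<in> {0..<2 * pi}" "as ! j \<in> {0..<2 * pi}"
        using as(2) ij nth_mem by (meson le_less_trans subsetD)+
      ultimately show "0 \<le> as ! j - as ! i \<and> as ! j - as ! i \<le> 2 * pi" by auto
    qed
    also have "\<dots> \<le> (\<Sum>s\<in>{1..<n}. real n * arc_trunc t (2 * pi * real s / real n))"
      by (intro sum_mono arc_trunc_step_sum_le) auto
    also have "\<dots> = (\<Sum>s\<in>{1..<n}. (\<Sum>i<n-s. arc_trunc t (?R ! (i + s) - ?R ! i))
          + (\<Sum>i<s. arc_trunc t (?R ! (i + (n - s)) - ?R ! i)))"
    proof (rule sum.cong[OF refl])
      fix s assume s: "s \<in> {1..<n}"
      then show "real n * arc_trunc t (2 * pi * real s / real n)
        = (\<Sum>i<n-s. arc_trunc t (?R ! (i + s) - ?R ! i))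
          + (\<Sum>i<s. arc_trunc t (?R ! (i + (n - s)) - ?R ! i))"
        by (intro arc_trunc_step_sum_equal_gaps[symmetric]) (auto simp: regular_angles_def)
    qed
    also have "\<dots> = 2 * sum_list (map (min t) (pair_values angular_dist (map circle_pt ?R)))"
    proof -
      have "0 \<le> ?R ! j - ?R ! i \<and> ?R ! j - ?R ! i \<le> 2 * pi" if "i \<le> j" "j < length ?R" for i j
      proof -
        have "0 \<le> 2 * pi / real n" by simp
        then have "2 * pi - 2 * pi / real n \<le> 2 * pi" by linarith
        then show ?thesis
          using regular_angles_diff_bounds[of i j n \<theta>] that
          by (metis length_regular_angles order.trans)
      qed
      from twice_truncated_sum_eq_step_sums[OF this, of t] show ?thesis by simp
    qed
    finally show "sum_list (map (min t) (pair_values angular_dist (map circle_pt as)))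
        \<le> sum_list (map (min t) (pair_values angular_dist (map circle_pt ?R)))"
      by simp
  qed
  then show ?thesis
    using dominates_mset_cong mset_angular_pair_values_cong[OF as(3)] by blast
qed

text \<open>
  In the order of the angles, \<open>n - 1\<close> gaps of size at least \<open>g = 2 * pi / n\<close> push the \<open>i\<close>-th angle
  up to at least \<open>i * g\<close> beyond the first one.  The gap across the origin keeps the last angle within
  \<open>2 * pi - g\<close> of the first, which gives the opposite inequality when counting down from the
  last.
\<close>

lemma regular_if_separated:
  assumes Y: "set Y \<subseteq> unit_circle" "length Y = n" and n: "2 \<le> n"
    and sep: "\<And>d. d \<in> set (pair_values angular_dist Y) \<Longrightarrow> 2 * pi / real n \<le> d"
  shows "is_regular_ngon n Y"
proof -
  obtain as where as: "sorted as" "set as \<subseteq> {0..<2 * pi}" "mset Y = mset (map circle_pt as)"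
    using ex_sorted_angles[OF Y(1)] .
  have len: "length as = n" using as(3) Y(2) by (metis length_map mset_eq_length)
  define g where "g = 2 * pi / real n"
  have ng: "real n * g = 2 * pi" using n by (simp add: g_def)
  have gap: "g \<le> as ! j - as ! i \<and> g \<le> 2 * pi - (as ! j - as ! i)" if ij: "i < j" "j < n" for i j
  proof -
    let ?d = "angular_dist (circle_pt (as ! i)) (circle_pt (as ! j))"
    have "?d \<in> set (pair_values angular_dist (map circle_pt as))"
      using pair_value_mem[of i j "map circle_pt as" angular_dist] ij len by simp
    then have "?d \<in> set (pair_values angular_dist Y)"
      using mset_eq_setD[OF mset_angular_pair_values_cong[OF as(3)]] by blast
    then have "g \<le> ?d" unfolding g_def by (rule sep)
    moreover have "as ! i \<le> as ! j" using as(1) ij len by (simp add: sorted_nth_mono)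
    moreover have "as ! i \<in> {0..<2 * pi}" "as ! j \<in> {0..<2 * pi}"
      using as(2) ij len by (meson less_trans nth_mem subsetD)+
    ultimately show ?thesis
      by (auto simp: angular_dist_circle_pt)
  qed
  have lower: "real k * g \<le> as ! (i + k) - as ! i" if "i + k < n" for i k
    using that
  proof (induction k)
    case (Suc k)
    then show ?case using gap[of "i + k" "i + Suc k"] by (simp add: algebra_simps)
  qed simp
  have nth: "as ! i = as ! 0 + real i * g" if i: "i < n" for i
  proof (rule antisym)
    have "real (n - 1 - i) * g \<le> as ! (n - 1) - as ! i"
      using lower[of i "n - 1 - i"] i by simp
    moreover have "real (n - 1 - i) * g = 2 * pi - g - real i * g"
      using i ng by (simp add: of_nat_diff algebra_simps)
    moreover have "g \<le> 2 * pi - (as ! (n - 1) - as ! 0)"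
      using gap[of 0 "n - 1"] n by simp
    ultimately show "as ! i \<le> as ! 0 + real i * g" by linarith
    show "as ! 0 + real i * g \<le> as ! i" using lower[of 0 i] i by simp
  qed
  have "as = regular_angles n (as ! 0)"
  proof (rule nth_equalityI)
    fix i assume "i < length as"
    then show "as ! i = regular_angles n (as ! 0) ! i"
      using nth[of i] len by (simp add: regular_angles_def g_def mult.commute)
  qed (simp add: len)
  then show ?thesis
    unfolding is_regular_ngon_iff_mset using as(3) by metis
qed

lemma M_sets_eq_regular:
  assumes n: "2 \<le> n"
  shows "M_sets unit_circle angular_dist n = {X. is_regular_ngon n X}"
proof (intro set_eqI iffI)
  fix X assume X: "X \<in> M_sets unit_circle angular_dist n"
  let ?R = "map circle_pt (regular_angles n 0)"
  have X': "set X \<subseteq> unit_circle" "length X = n"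
    using X by (auto simp: M_sets_def tuples_def)
  have "?R \<in> tuples unit_circle n" by (auto simp: tuples_def)
  then have "pair_values angular_dist X \<triangleright> pair_values angular_dist ?R"
    using X regular_polygon_dominates[OF X', of 0]
    unfolding M_sets_def incomparable_def by blast
  then show "X \<in> {X. is_regular_ngon n X}"
    using regular_if_separated[OF X' n] dominates_imp_lower_bound regular_polygon_dist_ge by blast
next
  fix X assume "X \<in> {X. is_regular_ngon n X}"
  then obtain \<theta> where \<theta>: "mset X = mset (map circle_pt (regular_angles n \<theta>))"
    by (auto simp: is_regular_ngon_iff_mset)
  have "length X = n"
    using \<theta> by (metis length_map length_regular_angles mset_eq_length)
  moreover have "set X \<subseteq> unit_circle"
    unfolding mset_eq_setD[OF \<theta>] by auto
  moreover have "pair_values angular_dist X \<triangleright> pair_values angular_dist Y"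
    if "Y \<in> tuples unit_circle n" for Y
    using regular_polygon_dominates[of Y n \<theta>] that
      dominates_mset_cong[OF mset_angular_pair_values_cong[OF \<theta>] refl]
    by (auto simp: tuples_def)
  ultimately show "X \<in> M_sets unit_circle angular_dist n"
    by (auto simp: M_sets_def tuples_def)
qed

lemma ex_rotation:
  obtains f where "orthogonal_transformation f" "\<And>a. f (circle_pt a) = circle_pt (a + \<delta>)"
proof
  let ?f = "\<lambda>v :: real^2. vector [cos \<delta> * v$1 - sin \<delta> * v$2, sin \<delta> * v$1 + cos \<delta> * v$2] :: real^2"
  have "(cos \<delta> * p - sin \<delta> * q)\<^sup>2 + (sin \<delta> * p + cos \<delta> * q)\<^sup>2 = p\<^sup>2 + q\<^sup>2" for p q
  proof -
    have "(cos \<delta> * p - sin \<delta> * q)\<^sup>2 + (sin \<delta> * p + cos \<delta> * q)\<^sup>2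
        = ((sin \<delta>)\<^sup>2 + (cos \<delta>)\<^sup>2) * (p\<^sup>2 + q\<^sup>2)"
      by algebra
    then show ?thesis by simp
  qed
  moreover have "linear ?f"
    by (intro linearI) (simp_all add: vec_eq_iff forall_2 algebra_simps)
  ultimately show "orthogonal_transformation ?f"
    by (simp add: orthogonal_transformation norm_vec2)
  show "?f (circle_pt a) = circle_pt (a + \<delta>)" for a
    by (simp add: circle_pt_def vec_eq_iff forall_2 cos_add sin_add algebra_simps)
qed

lemma regular_ngons_isometric:
  assumes "is_regular_ngon n X" "is_regular_ngon n Y"
  shows "isometric_configs X Y"
proof -
  obtain \<theta> \<eta> where X: "mset X = mset (map circle_pt (regular_angles n \<theta>))"
    and Y: "mset Y = mset (map circle_pt (regular_angles n \<eta>))"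
    using assms by (auto simp: is_regular_ngon_iff_mset)
  obtain f where f: "orthogonal_transformation f" "\<And>a. f (circle_pt a) = circle_pt (a + (\<eta> - \<theta>))"
    using ex_rotation[of "\<eta> - \<theta>"] by blast
  have "map f (map circle_pt (regular_angles n \<theta>)) = map circle_pt (regular_angles n \<eta>)"
    by (simp add: f(2) regular_angles_def algebra_simps)
  then have "mset (map f X) = mset Y"
    by (metis X Y mset_map)
  with f(1) show ?thesis
    unfolding isometric_configs_def by blast
qed

theorem theorem3p2:
  fixes n :: nat
  assumes "n \<ge> 3"
  shows "M_sets unit_circle angular_dist n = {X. is_regular_ngon n X} \<and>
    (\<exists>X \<in> M_sets unit_circle angular_dist n.
       \<forall>Y \<in> M_sets unit_circle angular_dist n. isometric_configs X Y)"
proof -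
  have M: "M_sets unit_circle angular_dist n = {X. is_regular_ngon n X}"
    using assms by (intro M_sets_eq_regular) simp
  moreover have "is_regular_ngon n (map circle_pt (regular_angles n 0))"
    by (auto simp: is_regular_ngon_iff_mset)
  ultimately show ?thesis
    using regular_ngons_isometric by blast
qed

end
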